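(* Let $n,m$ be positive integers. (1) Let $S_\infty=(\mathbb{R}^n\times S^1,g_{m,\infty},\mu_\infty)$ with $$g_{m,\infty}=\frac{1}{m^2(1+\|y\|^2)}(dt)^2+\sum_{i=1}^n(dy_i)^2,\qquad d\mu_\infty=dy_1\cdots dy_n\,dt,$$ where $y=(y_1,\dots,y_n)\in\mathbb{R}^n$ and $e^{\sqrt{-1}t}\in S^1$, with the isometric $S^1$-action $(y,e^{\sqrt{-1}t})\cdot e^{\sqrt{-1}\tau}=(y,e^{\sqrt{-1}(t+m\tau)})$. Then $\dim W(n+1)=1$ if $m=1$, and $\dim W(n+1)=0$ if $m>1$. (2) Let $S_\infty=(\mathbb{R}^n,\sum_i(dy_i)^2,dy_1\cdots dy_n)$ with the trivial $S^1$-action. Then $\dim W(n+1)=0$. Here $W(n+1)$ denotes the eigenspace, associated with the eigenvalue $n+1$, of the Laplacian $\Delta_\infty\colon(C^\infty(S_\infty)\otimes\mathbb{C})^\rho\to(C^\infty(S_\infty)\otimes\mathbb{C})^\rho$ of the metric measure space $S_\infty$.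
   Context: The spaces in (1) and (2) are the pointed $S^1$-equivariant measured Gromov-Hausdorff limits (with base points forgotten) of the unit circle bundle of a prequantum line bundle $L$ over a $2n$-dimensional symplectic manifold with a Lagrangian fibration, along a family of compatible complex structures converging to the real polarization; the base point lies over a fiber which is Bohr-Sommerfeld for $L^{\otimes m}$ but not for lower positive powers in case (1), respectively over a fiber which is not Bohr-Sommerfeld for any positive power of $L$ in case (2). The Laplacian is the one associated with the metric and the measure of $S_\infty$: in case (1), $\Delta_\infty f=-\sum_{i=1}^n\frac{\partial^2 f}{\partial y_i^2}-m^2(1+\|y\|^2)\frac{\partial^2 f}{\partial t^2}$; in case (2), $\Delta_\infty f=-\sum_{i=1}^n\frac{\partial^2 f}{\partial y_i^2}$; both extended $\mathbb{C}$-linearly. $S^1$ acts on $C^\infty(S_\infty)\otimes\mathbb{C}$ (complex-valued smooth functions) by $(e^{\sqrt{-1}\tau}\cdot f)(u)=e^{-\sqrt{-1}\tau}f(u\cdot e^{\sqrt{-1}\tau})$, and $(C^\infty(S_\infty)\otimes\mathbb{C})^\rho$ is the subspace of invariant elements. Dimensions are over $\mathbb{C}$.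
   Formalization: W(n+1) is taken to consist of the eigenfunctions that are also square-integrable with respect to the measure of S_∞, in all cases; with all smooth invariant functions the claim for m=1 fails (for n=1 the dimension is 2). *)

theory Defs
  imports "HOL-Analysis.Analysis" "HOL-Library.Function_Algebras"
begin

primrec k_smooth :: "nat \<Rightarrow> ('a::euclidean_space \<Rightarrow> 'b::real_normed_vector) \<Rightarrow> bool" where
  "k_smooth 0 f \<longleftrightarrow> continuous_on UNIV f"
| "k_smooth (Suc k) f \<longleftrightarrow>
     (\<forall>x. f differentiable (at x)) \<and> (\<forall>v. k_smooth k (\<lambda>x. frechet_derivative f (at x) v))"

definition smooth :: "('a::euclidean_space \<Rightarrow> 'b::real_normed_vector) \<Rightarrow> bool" where
  "smooth f \<longleftrightarrow> (\<forall>k. k_smooth k f)"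

text \<open>A Riemannian metric on a Euclidean space sends a point to an inner product on the
  tangent space there. The gradient is characterised by \<open>G x (grad f x) v = df x v\<close>.\<close>

definition riem_gradient ::
  "('a::euclidean_space \<Rightarrow> 'a \<Rightarrow> 'a \<Rightarrow> real) \<Rightarrow> ('a \<Rightarrow> real) \<Rightarrow> 'a \<Rightarrow> 'a" where
  "riem_gradient G f x = (THE X. \<forall>v. G x X v = frechet_derivative f (at x) v)"

definition divergence :: "('a::euclidean_space \<Rightarrow> 'a) \<Rightarrow> 'a \<Rightarrow> real" where
  "divergence X x = (\<Sum>b\<in>Basis. frechet_derivative (\<lambda>z. X z \<bullet> b) (at x) b)"

text \<open>The Laplacian of a metric measure space is \<open>- div\<^sub>\<mu> (grad f)\<close>, the divergence being
  minus the formal adjoint of the gradient with respect to the measure \<open>\<mu>\<close> (which need not be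
  the Riemannian volume). Here \<open>\<mu>\<close> is Lebesgue measure in the coordinates used, so
  \<open>div\<^sub>\<mu>\<close> is the coordinate divergence.\<close>

definition lebesgue_laplacian ::
  "('a::euclidean_space \<Rightarrow> 'a \<Rightarrow> 'a \<Rightarrow> real) \<Rightarrow> ('a \<Rightarrow> real) \<Rightarrow> 'a \<Rightarrow> real" where
  "lebesgue_laplacian G f x = - divergence (riem_gradient G f) x"

definition complex_linear_ext ::
  "(('a \<Rightarrow> real) \<Rightarrow> 'a \<Rightarrow> real) \<Rightarrow> ('a \<Rightarrow> complex) \<Rightarrow> 'a \<Rightarrow> complex" where
  "complex_linear_ext L f x = Complex (L (\<lambda>z. Re (f z)) x) (L (\<lambda>z. Im (f z)) x)"

typedef circle = "sphere (0::complex) 1"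
  by (rule exI[of _ 1]) simp

definition circ :: "real \<Rightarrow> circle" where
  "circ t = Abs_circle (cis t)"

text \<open>The measure \<open>dt\<close> on the circle, of total mass \<open>2\<pi>\<close>.\<close>

definition circle_measure :: "circle measure" where
  "circle_measure =
     distr (restrict_space lborel {0..<2 * pi}) (vimage_algebra UNIV Rep_circle borel) circ"

definition invariant_functions :: "('a \<Rightarrow> circle \<Rightarrow> 'a) \<Rightarrow> ('a \<Rightarrow> complex) set" where
  "invariant_functions act = {f. \<forall>s u. inverse (Rep_circle s) * f (act u s) = f u}"

text \<open>The eigenspace of an operator \<open>L\<close> on the invariant members of a function space \<open>C\<close>.
  As the Laplacian of a metric measure space is an operator on \<open>L\<^sup>2\<close>,
  eigenfunctions are required to be square-integrable; already for \<open>- g'' + y\<^sup>2 g = g\<close> on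
  the real line there are further smooth solutions, which are not in \<open>L\<^sup>2\<close>.\<close>

definition invariant_eigenspace ::
  "('a \<Rightarrow> complex) set \<Rightarrow> ('a \<Rightarrow> circle \<Rightarrow> 'a) \<Rightarrow> 'a measure \<Rightarrow>
   (('a \<Rightarrow> complex) \<Rightarrow> 'a \<Rightarrow> complex) \<Rightarrow> real \<Rightarrow> ('a \<Rightarrow> complex) set" where
  "invariant_eigenspace C act \<mu> L ev =
     {f \<in> C \<inter> invariant_functions act.
        integrable \<mu> (\<lambda>u. (cmod (f u))\<^sup>2) \<and> (\<forall>u. L f u = of_real ev * f u)}"

text \<open>Functions on \<open>\<real>\<^sup>n \<times> S\<^sup>1\<close> are studied through their pullbacks along the universal
  covering \<open>(y, t) \<mapsto> (y, e\<^sup>i\<^sup>t)\<close>. The suffix \<open>BS\<close> marks the limit space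
  \<open>\<real>\<^sup>n \<times> S\<^sup>1\<close> over a Bohr-Sommerfeld fiber, \<open>nonBS\<close> the limit space \<open>\<real>\<^sup>n\<close>.\<close>

definition cover :: "('v \<times> real) \<Rightarrow> ('v \<times> circle)" where
  "cover p = (fst p, circ (snd p))"

definition smooth_BS :: "((real^'n) \<times> circle \<Rightarrow> complex) set" where
  "smooth_BS = {f. smooth (\<lambda>p. f (cover p))}"

definition metric_BS ::
  "nat \<Rightarrow> (real^'n) \<times> real \<Rightarrow> (real^'n) \<times> real \<Rightarrow> (real^'n) \<times> real \<Rightarrow> real" where
  "metric_BS m p v w =
     1 / ((real m)\<^sup>2 * (1 + (norm (fst p))\<^sup>2)) * snd v * snd w
     + (\<Sum>i\<in>UNIV. fst v $ i * fst w $ i)"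

definition measure_BS :: "((real^'n) \<times> circle) measure" where
  "measure_BS = lborel \<Otimes>\<^sub>M circle_measure"

definition action_BS :: "nat \<Rightarrow> (real^'n) \<times> circle \<Rightarrow> circle \<Rightarrow> (real^'n) \<times> circle" where
  "action_BS m u s = (fst u, Abs_circle (Rep_circle (snd u) * Rep_circle s ^ m))"

text \<open>The choice of the preimage \<open>(y, Arg z)\<close> of \<open>(y, z)\<close> is immaterial, see
  \<open>laplacian_BS_cover\<close> below.\<close>

definition laplacian_BS ::
  "nat \<Rightarrow> ((real^'n) \<times> circle \<Rightarrow> complex) \<Rightarrow> (real^'n) \<times> circle \<Rightarrow> complex" where
  "laplacian_BS m f u =
     complex_linear_ext (lebesgue_laplacian (metric_BS m)) (\<lambda>p. f (cover p))
       (fst u, Arg (Rep_circle (snd u)))"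

definition W_BS :: "nat \<Rightarrow> real \<Rightarrow> ((real^'n) \<times> circle \<Rightarrow> complex) set" where
  "W_BS m ev = invariant_eigenspace smooth_BS (action_BS m) measure_BS (laplacian_BS m) ev"

definition metric_nonBS :: "real^'n \<Rightarrow> real^'n \<Rightarrow> real^'n \<Rightarrow> real" where
  "metric_nonBS p v w = (\<Sum>i\<in>UNIV. v $ i * w $ i)"

definition laplacian_nonBS :: "(real^'n \<Rightarrow> complex) \<Rightarrow> real^'n \<Rightarrow> complex" where
  "laplacian_nonBS f = complex_linear_ext (lebesgue_laplacian metric_nonBS) f"

definition W_nonBS :: "real \<Rightarrow> (real^'n \<Rightarrow> complex) set" where
  "W_nonBS ev = invariant_eigenspace {f. smooth f} (\<lambda>u s. u) lborel laplacian_nonBS ev"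

interpretation cfun: vector_space "\<lambda>(c::complex) (f::'a \<Rightarrow> complex) x. c * f x"
  by unfold_locales (auto simp: fun_eq_iff algebra_simps)

text \<open>The library's \<open>dim\<close> is 0 on infinite-dimensional spaces, hence the extra conjunct.\<close>

definition has_cdim :: "('a \<Rightarrow> complex) set \<Rightarrow> nat \<Rightarrow> bool" where
  "has_cdim W d \<longleftrightarrow> (\<exists>B. finite B \<and> cfun.span B = W) \<and> cfun.dim W = d"

lemma Rep_circ [simp]: "Rep_circle (circ t) = cis t"
  by (simp add: circ_def Abs_circle_inverse)

lemma circ_eq_iff: "circ s = circ t \<longleftrightarrow> cis s = cis t"
  by (metis Rep_circ circ_def)

lemma circ_Arg: "circ (Arg (Rep_circle z)) = z"
proof -
  have "norm (Rep_circle z) = 1" using Rep_circle[of z] by simp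
  then have "cis (Arg (Rep_circle z)) = Rep_circle z"
    by (subst cis_Arg) (auto simp: sgn_eq)
  then show ?thesis by (simp add: circ_def Rep_circle_inverse)
qed

lemma measurable_circ:
  "circ \<in> restrict_space lborel {0..<2 * pi} \<rightarrow>\<^sub>M vimage_algebra UNIV Rep_circle borel"
proof (rule measurable_vimage_algebra2)
  show "(\<lambda>x. Rep_circle (circ x)) \<in> restrict_space lborel {0..<2 * pi} \<rightarrow>\<^sub>M borel"
    by (simp, intro measurable_restrict_space1)
       (auto intro!: borel_measurable_continuous_onI continuous_intros)
qed simp

lemma action_BS_cover: "action_BS m (cover (y, t)) (circ \<tau>) = cover (y, t + real m * \<tau>)"
  by (simp add: action_BS_def cover_def circ_def[of "t + _"] Complex.DeMoivre cis_mult)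

lemma k_smooth_2D:
  assumes "k_smooth 2 f"
  shows "f differentiable (at x)" "(\<lambda>x. frechet_derivative f (at x) v) differentiable (at x)"
  using assms by (auto simp: numeral_2_eq_2)

lemma frechet_derivative_shift:
  fixes f :: "'a::real_normed_vector \<Rightarrow> 'b::real_normed_vector"
  assumes "\<And>p. f (p + a) = f p"
  shows "frechet_derivative f (at (x + a)) = frechet_derivative f (at x)"
proof -
  have "(f has_derivative D) (at (x + a)) \<longleftrightarrow> (f has_derivative D) (at x)" for D
  proof
    assume *: "(f has_derivative D) (at (x + a))"
    have "((\<lambda>p. f (p + a)) has_derivative (\<lambda>h. D h)) (at x)"
      by (rule has_derivative_compose[where f="\<lambda>p. p + a" and f'="\<lambda>h. h" and g=f])
         (auto intro!: derivative_eq_intros *)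
    then show "(f has_derivative D) (at x)" using assms by simp
  next
    assume *: "(f has_derivative D) (at x)"
    have e: "f (p - a) = f p" for p using assms[of "p - a"] by simp
    have "((\<lambda>p. f (p - a)) has_derivative (\<lambda>h. D h)) (at (x + a))"
      by (rule has_derivative_compose[where f="\<lambda>p. p - a" and f'="\<lambda>h. h" and g=f])
         (auto intro!: derivative_eq_intros *)
    then show "(f has_derivative D) (at (x + a))" using e by simp
  qed
  then show ?thesis by (simp add: frechet_derivative_def)
qed

lemma lebesgue_laplacian_shift:
  assumes "\<And>p. f (p + a) = f p" and "\<And>p. G (p + a) = G p"
  shows "lebesgue_laplacian G f (x + a) = lebesgue_laplacian G f x"
proof -
  have "riem_gradient G f (p + a) = riem_gradient G f p" for p
    by (simp add: riem_gradient_def assms frechet_derivative_shift[of f a, OF assms(1)])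
  then show ?thesis
    unfolding lebesgue_laplacian_def divergence_def
    by (subst frechet_derivative_shift) simp_all
qed

lemma laplacian_BS_cover:
  "laplacian_BS m f (cover (y, t)) =
     complex_linear_ext (lebesgue_laplacian (metric_BS m)) (\<lambda>p. f (cover p)) (y, t)"
proof -
  define s where "s = Arg (cis t)"
  have "circ t = circ s"
    using circ_Arg[of "circ t"] by (simp add: s_def)
  then have cs: "cis t = cis s" by (simp add: circ_eq_iff)
  define a where "a = s - t"
  have "cis a = 1" using cs by (simp add: a_def flip: cis_divide)
  then have per: "cover (p + (0, a)) = cover p" for p :: "(real^'a) \<times> real"
    by (simp add: cover_def circ_def flip: cis_mult)
  have G: "metric_BS m (p + (0, a)) = metric_BS m p" for p :: "(real^'a) \<times> real"
    by (simp add: metric_BS_def fun_eq_iff)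
  have "lebesgue_laplacian (metric_BS m) (\<lambda>p. g (f (cover p))) ((y, t) + (0, a)) =
        lebesgue_laplacian (metric_BS m) (\<lambda>p. g (f (cover p))) (y, t)" for g :: "complex \<Rightarrow> real"
    by (rule lebesgue_laplacian_shift) (simp_all add: per G)
  then show ?thesis
    by (simp add: laplacian_BS_def complex_linear_ext_def s_def[symmetric] a_def cover_def)
qed

lemma lebesgue_laplacian_nonBS:
  fixes f :: "real^'n \<Rightarrow> real"
  assumes "k_smooth 2 f"
  shows "lebesgue_laplacian metric_nonBS f y =
    - (\<Sum>i\<in>UNIV. frechet_derivative
         (\<lambda>z. frechet_derivative f (at z) (axis i 1)) (at y) (axis i 1))"
proof -
  note [simp] = k_smooth_2D(1)[OF assms]
  have G: "metric_nonBS p v w = v \<bullet> w" for p v w :: "real^'n"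
    by (simp add: metric_nonBS_def inner_vec_def)
  have lin: "linear (frechet_derivative f (at z))" for z
    by (simp add: linear_frechet_derivative)
  have grad: "riem_gradient metric_nonBS f z =
    (\<chi> i. frechet_derivative f (at z) (axis i 1))" for z
    unfolding riem_gradient_def G
  proof (rule the_equality)
    show "\<forall>v. (\<chi> i. frechet_derivative f (at z) (axis i 1)) \<bullet> v = frechet_derivative f (at z) v"
    proof
      fix v :: "real^'n"
      have "frechet_derivative f (at z) v = frechet_derivative f (at z) (\<Sum>i\<in>UNIV. v $ i *\<^sub>R axis i 1)"
        by (simp add: basis_expansion flip: scalar_mult_eq_scaleR)
      also have "\<dots> = (\<Sum>i\<in>UNIV. v $ i * frechet_derivative f (at z) (axis i 1))"
        by (simp add: linear_sum[OF lin] linear_scale[OF lin])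
      finally show "(\<chi> i. frechet_derivative f (at z) (axis i 1)) \<bullet> v = frechet_derivative f (at z) v"
        by (simp add: inner_vec_def mult.commute)
    qed
  next
    fix X assume "\<forall>v. X \<bullet> v = frechet_derivative f (at z) v"
    then show "X = (\<chi> i. frechet_derivative f (at z) (axis i 1))"
      by (simp add: vec_eq_iff) (simp add: cart_eq_inner_axis)
  qed
  have B: "Basis = range (\<lambda>i::'n. axis i (1::real))" by (auto simp: Basis_vec_def)
  have inj: "inj (\<lambda>i::'n. axis i (1::real))" by (auto simp: inj_on_def axis_eq_axis)
  show ?thesis
    unfolding lebesgue_laplacian_def divergence_def B sum.reindex[OF inj]
    by (simp add: grad flip: cart_eq_inner_axis)
qed

lemma lebesgue_laplacian_BS:
  fixes f :: "(real^'n) \<times> real \<Rightarrow> real"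
  assumes f: "k_smooth 2 f" and m: "m > 0"
  shows "lebesgue_laplacian (metric_BS m) f (y, t) =
    - (\<Sum>i\<in>UNIV. frechet_derivative
         (\<lambda>z. frechet_derivative f (at z) (axis i 1, 0)) (at (y, t)) (axis i 1, 0))
    - (real m)\<^sup>2 * (1 + (norm y)\<^sup>2) * frechet_derivative
         (\<lambda>z. frechet_derivative f (at z) (0, 1)) (at (y, t)) (0, 1)"
proof -
  note [simp] = k_smooth_2D(1)[OF f]
  let ?c = "\<lambda>z::(real^'n) \<times> real. (real m)\<^sup>2 * (1 + (norm (fst z))\<^sup>2)"
  let ?D = "\<lambda>z. frechet_derivative f (at z)"
  have cpos: "?c z > 0" for z using m by (simp add: add_pos_nonneg)
  have cancel: "c * a * b / c = b * a" if "c > 0" for a b c :: real using that by simp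
  have G: "metric_BS m p v w = snd v * snd w / ?c p + fst v \<bullet> fst w" for p v w :: "(real^'n) \<times> real"
    by (simp add: metric_BS_def inner_vec_def)
  have lin: "linear (?D z)" for z
    by (simp add: linear_frechet_derivative)
  have exp: "?D z v = (\<Sum>i\<in>UNIV. fst v $ i * ?D z (axis i 1, 0)) + snd v * ?D z (0, 1)" for z v
  proof -
    have "v = (\<Sum>i\<in>UNIV. fst v $ i *\<^sub>R (axis i 1, 0)) + snd v *\<^sub>R (0, 1)"
      by (rule prod_eqI)
         (simp_all add: fst_sum snd_sum basis_expansion flip: scalar_mult_eq_scaleR)
    then have "?D z v = ?D z ((\<Sum>i\<in>UNIV. fst v $ i *\<^sub>R (axis i 1, 0)) + snd v *\<^sub>R (0, 1))"
      by simp
    then show ?thesis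
      by (simp add: linear_add[OF lin] linear_sum[OF lin] linear_scale[OF lin] del: scaleR_Pair)
  qed
  have grad: "riem_gradient (metric_BS m) f z =
    ((\<chi> i. ?D z (axis i 1, 0)), ?c z * ?D z (0, 1))" for z
    unfolding riem_gradient_def G
  proof (rule the_equality)
    show "\<forall>v. snd ((\<chi> i. ?D z (axis i 1, 0)), ?c z * ?D z (0, 1)) * snd v / ?c z
        + fst ((\<chi> i. ?D z (axis i 1, 0)), ?c z * ?D z (0, 1)) \<bullet> fst v = ?D z v"
    proof
      fix v :: "(real^'n) \<times> real"
      have "?c z * ?D z (0, 1) * snd v / ?c z = snd v * ?D z (0, 1)"
        by (rule cancel[OF cpos])
      then show "snd ((\<chi> i. ?D z (axis i 1, 0)), ?c z * ?D z (0, 1)) * snd v / ?c z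
          + fst ((\<chi> i. ?D z (axis i 1, 0)), ?c z * ?D z (0, 1)) \<bullet> fst v = ?D z v"
        unfolding exp[of z v] fst_conv snd_conv by (simp add: inner_vec_def mult.commute)
    qed
  next
    fix X assume X: "\<forall>v. snd X * snd v / ?c z + fst X \<bullet> fst v = ?D z v"
    have "fst X $ i = ?D z (axis i 1, 0)" for i
      using spec[OF X, of "(axis i 1, 0)"] by (simp add: cart_eq_inner_axis)
    moreover have "snd X = ?c z * ?D z (0, 1)"
      using spec[OF X, of "(0, 1)"] cpos[of z] by (simp add: field_simps)
    ultimately show "X = ((\<chi> i. ?D z (axis i 1, 0)), ?c z * ?D z (0, 1))"
      by (auto intro!: prod_eqI simp: vec_eq_iff)
  qed
  have B: "(Basis :: ((real^'n) \<times> real) set) =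
      insert (0, 1) (range (\<lambda>i. (axis i 1, 0)))"
    by (auto simp: Basis_prod_def Basis_vec_def)
  have inj: "inj (\<lambda>i::'n. (axis i (1::real), 0::real))" by (auto simp: inj_on_def axis_eq_axis)
  have n: "(0, 1) \<notin> range (\<lambda>i::'n. (axis i (1::real), 0::real))" by auto
  have c: "frechet_derivative (\<lambda>z. ?c z * ?D z (0, 1)) (at (y, t)) (0, 1) =
     ?c (y, t) * frechet_derivative (\<lambda>z. ?D z (0, 1)) (at (y, t)) (0, 1)"
  proof -
    have d: "((\<lambda>z. ?D z (0, 1)) has_derivative
        frechet_derivative (\<lambda>z. ?D z (0, 1)) (at (y, t))) (at (y, t))"
      using k_smooth_2D(2)[OF f] by (simp add: frechet_derivative_works[symmetric])
    have e: "?c z = (real m)\<^sup>2 * (1 + fst z \<bullet> fst z)" for z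
      by (simp add: power2_norm_eq_inner)
    have "((\<lambda>z. (real m)\<^sup>2 * (1 + fst z \<bullet> fst z) * ?D z (0, 1)) has_derivative
      (\<lambda>h. (real m)\<^sup>2 * (1 + y \<bullet> y) * frechet_derivative (\<lambda>z. ?D z (0, 1)) (at (y, t)) h
         + (real m)\<^sup>2 * (2 * (y \<bullet> fst h)) * ?D (y, t) (0, 1))) (at (y, t))"
      by (auto intro!: derivative_eq_intros d simp: inner_commute algebra_simps)
    from frechet_derivative_at[OF this, symmetric] show ?thesis
      by (simp add: e power2_norm_eq_inner)
  qed
  show ?thesis
    unfolding lebesgue_laplacian_def divergence_def B
    using c by (subst sum.insert) (simp_all add: n sum.reindex[OF inj] grad flip: cart_eq_inner_axis)
qed

lemma frechet_derivative_bounded_linear: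
  assumes "bounded_linear g" "f differentiable (at x)"
  shows "frechet_derivative (\<lambda>z. g (f z)) (at x) v = g (frechet_derivative f (at x) v)"
proof -
  have "((\<lambda>z. g (f z)) has_derivative (\<lambda>h. g (frechet_derivative f (at x) h))) (at x)"
    by (rule bounded_linear.has_derivative
          [OF assms(1) iffD1[OF frechet_derivative_works assms(2)]])
  from frechet_derivative_at[OF this, symmetric] show ?thesis by simp
qed

lemma k_smooth_bounded_linear:
  assumes "bounded_linear g" "k_smooth k f"
  shows "k_smooth k (\<lambda>z. g (f z))"
  using assms(2)
proof (induction k arbitrary: f)
  case 0
  then show ?case by (simp add: bounded_linear.continuous_on[OF assms(1)])
next
  case (Suc k)
  then have d: "f differentiable (at x)" for x by simp
  moreover have "(\<lambda>z. g (f z)) differentiable (at x)" for x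
    by (rule differentiableI, rule bounded_linear.has_derivative
          [OF assms(1) iffD1[OF frechet_derivative_works d]])
  ultimately show ?case
    using Suc by (simp add: frechet_derivative_bounded_linear[OF assms(1)])
qed

lemma frechet_derivative_bounded_linear_2:
  assumes "bounded_linear g" "k_smooth 2 f"
  shows "frechet_derivative (\<lambda>z. frechet_derivative (\<lambda>z. g (f z)) (at z) v) (at x) w =
    g (frechet_derivative (\<lambda>z. frechet_derivative f (at z) v) (at x) w)"
  using k_smooth_2D[OF assms(2)] by (simp add: frechet_derivative_bounded_linear[OF assms(1)])

theorem laplacian_nonBS_formula:
  fixes f :: "real^'n \<Rightarrow> complex"
  assumes "smooth f"
  shows "laplacian_nonBS f y =
    - (\<Sum>i\<in>UNIV. frechet_derivative
         (\<lambda>z. frechet_derivative f (at z) (axis i 1)) (at y) (axis i 1))"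
proof -
  have f: "k_smooth 2 f" using assms by (simp add: smooth_def)
  show ?thesis
    unfolding laplacian_nonBS_def complex_linear_ext_def
    by (simp only: complex_eq_iff complex.sel uminus_complex.sel Re_sum Im_sum
        lebesgue_laplacian_nonBS[OF k_smooth_bounded_linear[OF bounded_linear_Re f]]
        lebesgue_laplacian_nonBS[OF k_smooth_bounded_linear[OF bounded_linear_Im f]]
        frechet_derivative_bounded_linear_2[OF bounded_linear_Re f]
        frechet_derivative_bounded_linear_2[OF bounded_linear_Im f])
qed

theorem laplacian_BS_formula:
  fixes f :: "(real^'n) \<times> circle \<Rightarrow> complex"
  assumes "f \<in> smooth_BS" and m: "m > 0"
  defines "F \<equiv> \<lambda>p. f (cover p)"
  shows "laplacian_BS m f (y, circ t) =
    - (\<Sum>i\<in>UNIV. frechet_derivative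
         (\<lambda>z. frechet_derivative F (at z) (axis i 1, 0)) (at (y, t)) (axis i 1, 0))
    - of_real ((real m)\<^sup>2 * (1 + (norm y)\<^sup>2)) * frechet_derivative
         (\<lambda>z. frechet_derivative F (at z) (0, 1)) (at (y, t)) (0, 1)"
proof -
  have F: "k_smooth 2 F" using assms(1) by (simp add: smooth_BS_def smooth_def F_def)
  have "laplacian_BS m f (y, circ t) =
      complex_linear_ext (lebesgue_laplacian (metric_BS m)) F (y, t)"
    using laplacian_BS_cover[of m f y t] by (simp add: cover_def F_def)
  also have "\<dots> =
    - (\<Sum>i\<in>UNIV. frechet_derivative
         (\<lambda>z. frechet_derivative F (at z) (axis i 1, 0)) (at (y, t)) (axis i 1, 0))
    - of_real ((real m)\<^sup>2 * (1 + (norm y)\<^sup>2)) * frechet_derivative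
         (\<lambda>z. frechet_derivative F (at z) (0, 1)) (at (y, t)) (0, 1)"
    unfolding complex_linear_ext_def
    by (simp only: complex_eq_iff complex.sel uminus_complex.sel minus_complex.sel Re_sum Im_sum
        lebesgue_laplacian_BS[OF k_smooth_bounded_linear[OF bounded_linear_Re F] m]
        lebesgue_laplacian_BS[OF k_smooth_bounded_linear[OF bounded_linear_Im F] m]
        frechet_derivative_bounded_linear_2[OF bounded_linear_Re F]
        frechet_derivative_bounded_linear_2[OF bounded_linear_Im F]
        flip: scaleR_conv_of_real) (simp add: scaleR_complex.sel)
  finally show ?thesis .
qed

end

theory Submission
  imports Defs "HOL-Probability.Distributions"
begin

text \<open>On invariant functions everything reduces to \<open>\<real>\<^sup>n\<close>. For \<open>m > 1\<close> a primitive \<open>m\<close>-th root of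
  unity acts trivially on the space but multiplies the value of an invariant function, which is
  therefore zero; over a fiber that is not Bohr-Sommerfeld all of \<open>S\<^sup>1\<close> does. For \<open>m = 1\<close> an invariant
  function is \<open>f (y, z) = z * g y\<close>, and the eigenvalue equation becomes that of the ground state of the
  harmonic oscillator, \<open>- \<Delta> g + |y|\<^sup>2 g = n g\<close>. With \<open>A = \<nabla> g + g y\<close> and a cutoff \<open>p\<close> this equation gives
  \<open>div (p\<^sup>2 g A) = p\<^sup>2 |A|\<^sup>2 + g \<nabla>(p\<^sup>2) \<bullet> A\<close>. Integrating with \<open>p\<close> supported in the ball of radius \<open>R\<close> and
  \<open>|\<nabla> p|\<close> of order \<open>1 / R\<close> bounds the integral of \<open>p\<^sup>2 |A|\<^sup>2\<close> by a constant times \<open>\<parallel>g\<parallel>\<^sup>2 / R\<^sup>2\<close>, so \<open>A = 0\<close>, that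
  is, \<open>g\<close> is a multiple of \<open>exp (- |y|\<^sup>2 / 2)\<close>.\<close>

section \<open>Pullback along linear maps\<close>

lemma frechet_derivative_comp_bounded_linear:
  assumes l: "bounded_linear l" and "F differentiable at (l y)"
  shows "frechet_derivative (\<lambda>y. F (l y)) (at y) v = frechet_derivative F (at (l y)) (l v)"
proof -
  have "((\<lambda>y. F (l y)) has_derivative (\<lambda>h. frechet_derivative F (at (l y)) (l h))) (at y)"
    using assms bounded_linear_imp_has_derivative[OF l, of "at y"]
    by (intro has_derivative_compose[of l l y UNIV F])
       (auto simp: frechet_derivative_works[symmetric])
  from frechet_derivative_at[OF this, symmetric] show ?thesis by simp
qed

text \<open>Serves to restrict a function on the covering to the slice \<open>t = 0\<close>. The
  induction goes through because the derivative along \<open>v\<close> is the derivative of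
  \<open>F\<close> along the constant vector \<open>l v\<close>, again composed with
  \<open>l\<close>.\<close>

lemma k_smooth_comp_bounded_linear:
  assumes l: "bounded_linear l" and F: "k_smooth k F"
  shows "k_smooth k (\<lambda>y. F (l y))"
  using F
proof (induction k arbitrary: F)
  case 0
  then show ?case
    by (auto intro: continuous_on_compose2[of UNIV F UNIV l] linear_continuous_on[OF l])
next
  case (Suc k)
  then have "(\<lambda>y. F (l y)) differentiable at y" for y
    using bounded_linear_imp_differentiable[OF l] differentiable_chain_at[of l y F]
    by (simp add: o_def)
  moreover have "k_smooth k (\<lambda>y. frechet_derivative F (at (l y)) (l v))" for v
    using Suc.prems by (intro Suc.IH) simp
  ultimately show ?case
    using Suc.prems by (simp add: frechet_derivative_comp_bounded_linear[OF l])
qed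

section \<open>Integration over Euclidean space\<close>

lemma integrable_continuous_compact_support:
  fixes h :: "'a::euclidean_space \<Rightarrow> real"
  assumes "continuous_on UNIV h" "\<And>x. norm x > R \<Longrightarrow> h x = 0"
  shows "integrable lborel h"
proof -
  have "integrable lborel (\<lambda>x. indicator (cball 0 R) x *\<^sub>R h x)"
    by (rule borel_integrable_compact) (auto intro: continuous_on_subset[OF assms(1)])
  also have "(\<lambda>x. indicator (cball 0 R) x *\<^sub>R h x) = h"
    using assms(2) by (force simp: indicator_def)
  finally show ?thesis .
qed

text \<open>The zero set is closed and of full measure; its complement is an open null set, hence
  empty.\<close>

lemma continuous_AE_lborel_eq_0:
  fixes h :: "'a::euclidean_space \<Rightarrow> real"
  assumes "continuous_on UNIV h" "AE x in lborel. h x = 0"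
  shows "h x = 0"
proof -
  have "closed {x. h x = 0}"
    using assms(1) by (intro closed_Collect_eq) auto
  moreover have "AE x in lebesgue. x \<in> {x. h x = 0}"
    using assms(2) by (auto intro: AE_completion)
  ultimately show ?thesis
    using mem_closed_if_AE_lebesgue by blast
qed

text \<open>By translation invariance, the difference quotients in the direction \<open>b\<close> have integral 0.\<close>

lemma integral_directional_derivative_eq_0:
  fixes F :: "'a::euclidean_space \<Rightarrow> real"
  assumes F: "\<And>x. (F has_derivative F' x) (at x)"
    and cont: "continuous_on UNIV (\<lambda>x. F' x b)"
    and supp: "\<And>x. norm x > R \<Longrightarrow> F x = 0"
  shows "(\<integral>x. F' x b \<partial>lborel) = 0"
proof -
  have contF: "continuous_on UNIV F"
    by (intro continuous_at_imp_continuous_on ballI has_derivative_continuous[OF F])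
  have intF: "integrable lborel F"
    by (rule integrable_continuous_compact_support[OF contF supp])
  have trans: "integrable lborel (\<lambda>x. F (c + x))" "(\<integral>x. F (c + x) \<partial>lborel) = (\<integral>x. F x \<partial>lborel)" for c
  proof -
    have [measurable]: "F \<in> borel_measurable borel"
      by (rule borel_measurable_continuous_onI[OF contF])
    have "integrable (distr lborel borel ((+) c)) F"
      using intF by (simp add: lborel_distr_plus)
    then show "integrable lborel (\<lambda>x. F (c + x))"
      by (subst (asm) integrable_distr_eq) auto
    have "(\<integral>x. F x \<partial>lborel) = (\<integral>x. F x \<partial>(distr lborel borel ((+) c)))"
      by (simp add: lborel_distr_plus)
    also have "\<dots> = (\<integral>x. F (c + x) \<partial>lborel)"
      by (subst integral_distr) auto
    finally show "(\<integral>x. F (c + x) \<partial>lborel) = (\<integral>x. F x \<partial>lborel)" ..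
  qed
  \<comment> \<open>The mean value theorem below evaluates \<open>F'\<close> at points
    \<open>u *\<^sub>R b + x\<close> with \<open>0 < u < 1\<close> and
    \<open>norm x \<le> R + norm b\<close>; this ball contains all of them.\<close>
  have "compact ((\<lambda>x. F' x b) ` cball 0 (R + 2 * norm b))"
    by (intro compact_continuous_image continuous_on_subset[OF cont]) auto
  then have "bounded ((\<lambda>x. F' x b) ` cball 0 (R + 2 * norm b))"
    by (rule compact_imp_bounded)
  then obtain M where M: "\<bar>F' x b\<bar> \<le> M" if "norm x \<le> R + 2 * norm b" for x
    unfolding bounded_iff by fastforce
  have line: "((\<lambda>s. F (s *\<^sub>R b + x)) has_derivative (\<lambda>h. h * F' (s *\<^sub>R b + x) b)) (at s)" for s x
  proof -
    have "((\<lambda>s. F (s *\<^sub>R b + x)) has_derivative (\<lambda>h. F' (s *\<^sub>R b + x) (h *\<^sub>R b))) (at s)"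
      by (rule has_derivative_compose[OF _ F]) (auto intro!: derivative_eq_intros)
    moreover have "linear (F' z)" for z using F has_derivative_linear by blast
    ultimately show ?thesis by (simp add: linear_scale)
  qed
  \<comment> \<open>The step sizes \<open>1 / (k + 1)\<close> are nonzero and at most 1; the latter
    permits a dominating function independent of \<open>k\<close>.\<close>
  define q where "q k x = (F (inverse (real (Suc k)) *\<^sub>R b + x) - F x) * real (Suc k)" for k x
  have q0: "(\<integral>x. q k x \<partial>lborel) = 0" for k
    unfolding q_def using trans intF by simp
  have lim: "(\<lambda>k. q k x) \<longlonglongrightarrow> F' x b" for x
  proof -
    have "((\<lambda>s. F (s *\<^sub>R b + x)) has_field_derivative F' x b) (at 0)"
      using line[of x 0] by (simp add: has_field_derivative_def mult_commute_abs)
    then have "((\<lambda>h. (F (h *\<^sub>R b + x) - F x) / h) \<longlongrightarrow> F' x b) (at 0)"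
      by (simp add: DERIV_def)
    then have "(\<lambda>k. (F (inverse (real (Suc k)) *\<^sub>R b + x) - F x) / inverse (real (Suc k))) \<longlonglongrightarrow> F' x b"
      by (rule filterlim_compose)
         (simp add: filterlim_at LIMSEQ_inverse_real_of_nat del: of_nat_Suc)
    then show ?thesis by (simp add: q_def divide_inverse del: of_nat_Suc)
  qed
  have bound: "norm (q k x) \<le> M * indicator (cball 0 (R + norm b)) x" for k x
  proof -
    define s where "s = inverse (real (Suc k))"
    have s: "0 < s" "s \<le> 1"
      by (simp_all add: s_def inverse_le_1_iff del: of_nat_Suc)
    have q: "q k x = (F (s *\<^sub>R b + x) - F x) / s"
      by (simp add: s_def q_def divide_inverse del: of_nat_Suc)
    have sb: "norm (u *\<^sub>R b) \<le> norm b" if "\<bar>u\<bar> \<le> 1" for u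
      using that by (simp add: mult_left_le_one_le)
    show ?thesis
    proof (cases "norm x \<le> R + norm b")
      case True
      have "\<exists>u\<in>{0<..<s}. F (s *\<^sub>R b + x) - F (0 *\<^sub>R b + x) = (s - 0) * F' (u *\<^sub>R b + x) b"
        by (rule mvt_simple[OF s(1)]) (rule has_derivative_at_withinI[OF line])
      then obtain u where u: "0 < u" "u < s" "F (s *\<^sub>R b + x) - F x = s * F' (u *\<^sub>R b + x) b"
        by auto
      have "norm (u *\<^sub>R b + x) \<le> R + 2 * norm b"
        using norm_triangle_ineq[of "u *\<^sub>R b" x] sb[of u] u s True by simp
      from M[OF this] show ?thesis using u s True by (simp add: q)
    next
      \<comment> \<open>A shift by at most \<open>norm b\<close> cannot bring \<open>x\<close> back
        into the ball of radius \<open>R\<close>, so both values of \<open>F\<close> vanish.\<close>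
      case False
      have "norm x \<le> norm (s *\<^sub>R b + x) + norm (s *\<^sub>R b)"
        using norm_triangle_ineq4[of "s *\<^sub>R b + x" "s *\<^sub>R b"] by simp
      then have "R < norm (s *\<^sub>R b + x)"
        using False sb[of s] s by linarith
      moreover have "R < norm x" using False norm_ge_zero[of b] by linarith
      ultimately show ?thesis using False by (simp add: q supp)
    qed
  qed
  have "(\<lambda>k. \<integral>x. q k x \<partial>lborel) \<longlonglongrightarrow> (\<integral>x. F' x b \<partial>lborel)"
  proof (rule integral_dominated_convergence[where w = "\<lambda>x. M * indicator (cball 0 (R + norm b)) x"])
    show "(\<lambda>x. F' x b) \<in> borel_measurable lborel"
      using borel_measurable_continuous_onI[OF cont] by simp
    show "q k \<in> borel_measurable lborel" for k
      unfolding q_def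
      by simp (auto intro!: borel_measurable_continuous_onI continuous_intros continuous_on_compose2[OF contF])
    show "integrable lborel (\<lambda>x::'a. M * indicator (cball 0 (R + norm b)) x)"
      using emeasure_bounded_finite[of "cball (0::'a) (R + norm b)"]
      by (intro integrable_mult_right) (auto simp: integrable_indicator_iff)
  qed (use lim bound in auto)
  then show ?thesis
    by (simp add: q0 LIMSEQ_const_iff)
qed

text \<open>The integrand is a product over the coordinates and Lebesgue measure is the image of the
  product measure, which leaves the one-dimensional Gaussian. This gives the square integrability of
  the eigenfunction.\<close>

lemma integrable_exp_minus_norm_power2:
  "integrable lborel (\<lambda>x::'a::euclidean_space. exp (- (norm x)\<^sup>2))"
proof -
  interpret product_sigma_finite "\<lambda>b::'a. lborel :: real measure"
    by standard
  \<comment> \<open>\<open>gaussian_moment_0\<close> covers the half line; evenness of the integrand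
    supplies the other half.\<close>
  have "integrable lborel (\<lambda>x::real. exp (- x\<^sup>2))"
    using has_bochner_integral_even_function[OF gaussian_moment_0]
    by (auto simp: integrable.simps)
  then have "integrable (\<Pi>\<^sub>M b\<in>(Basis :: 'a set). (lborel :: real measure)) (\<lambda>x. \<Prod>b\<in>Basis. exp (- (x b)\<^sup>2))"
    by (intro product_integrable_prod) auto
  moreover have "(\<Prod>b\<in>Basis. exp (- (x b)\<^sup>2)) = exp (- (norm (\<Sum>b\<in>Basis. x b *\<^sub>R b :: 'a))\<^sup>2)" for x :: "'a \<Rightarrow> real"
  proof -
    have "(norm (\<Sum>b\<in>Basis. x b *\<^sub>R b :: 'a))\<^sup>2 = (\<Sum>b\<in>Basis. (x b)\<^sup>2)"
      unfolding power2_norm_eq_inner by (subst euclidean_inner) (simp add: power2_eq_square)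
    then show ?thesis by (simp add: exp_sum flip: sum_negf)
  qed
  ultimately have *: "integrable (\<Pi>\<^sub>M b\<in>(Basis :: 'a set). (lborel :: real measure))
      (\<lambda>x. exp (- (norm (\<Sum>b\<in>Basis. x b *\<^sub>R b :: 'a))\<^sup>2))"
    by simp
  show ?thesis
    by (subst lborel_eq, subst integrable_distr_eq) (use * in auto)
qed

section \<open>The ground state of the harmonic oscillator\<close>

lemma has_real_derivative_pos_part_square:
  "((\<lambda>s. (max 0 s)\<^sup>2) has_real_derivative 2 * max 0 s) (at s)"
proof -
  consider "s > 0" | "s < 0" | "s = 0" by linarith
  then show ?thesis
  proof cases
    case 1
    have "((\<lambda>s. s\<^sup>2) has_real_derivative 2 * max 0 s) (at s)"
      using 1 by (auto intro!: derivative_eq_intros)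
    then show ?thesis
      by (rule has_field_derivative_transform_within_open[of _ _ _ "{0<..}"]) (use 1 in auto)
  next
    case 2
    have "((\<lambda>s. 0) has_real_derivative 2 * max 0 s) (at s)"
      using 2 by (auto intro!: derivative_eq_intros)
    then show ?thesis
      by (rule has_field_derivative_transform_within_open[of _ _ _ "{..<0}"]) (use 2 in auto)
  next
    case 3
    \<comment> \<open>At the kink the difference quotient is \<open>(max 0 h)\<^sup>2 / h\<close>,
      bounded in absolute value by \<open>max 0 h\<close>.\<close>
    have "((\<lambda>h::real. max 0 h * (max 0 h / h)) \<longlongrightarrow> 0) (at 0)"
    proof (rule Lim_null_comparison)
      show "\<forall>\<^sub>F h::real in at 0. norm (max 0 h * (max 0 h / h)) \<le> max 0 h"
        by (rule always_eventually) (auto simp: max_def)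
      show "((\<lambda>h::real. max 0 h) \<longlongrightarrow> 0) (at 0)"
        using tendsto_max[OF tendsto_const tendsto_ident_at, of 0 "0::real" UNIV] by simp
    qed
    then show ?thesis
      unfolding 3 DERIV_def by (simp add: power2_eq_square)
  qed
qed

text \<open>With values in a real inner product space, complex \<open>g\<close> is covered without
  splitting it into real and imaginary parts. Square integrability makes the error caused by the
  cutoff vanish as \<open>R\<close> grows.\<close>

lemma harmonic_oscillator_ground_state:
  fixes g :: "'a::euclidean_space \<Rightarrow> 'b::real_inner"
  assumes g: "k_smooth 2 g"
    and eq: "\<And>x. (\<Sum>b\<in>Basis. frechet_derivative (\<lambda>z. frechet_derivative g (at z) b) (at x) b) =
      ((norm x)\<^sup>2 - DIM('a)) *\<^sub>R g x"
    and L2: "integrable lborel (\<lambda>x. (norm (g x))\<^sup>2)"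
  shows "g x = exp (- (norm x)\<^sup>2 / 2) *\<^sub>R g 0"
proof -
  define G where "G b x = frechet_derivative g (at x) b" for b x
  define H where "H b x = frechet_derivative (G b) (at x)" for b x
  \<comment> \<open>\<open>A b\<close> is the component along \<open>b\<close> of the field
    \<open>A\<close> introduced above, up to a factor the annihilation operator applied to
    \<open>g\<close>, and \<open>S\<close> is its squared length. The cutoff \<open>p R\<close> has
    a kink on the sphere of radius \<open>R\<close>, but only its square is differentiated, and that
    is continuously differentiable.\<close>
  define A where "A b x = G b x + (x \<bullet> b) *\<^sub>R g x" for b x
  define S where "S x = (\<Sum>b\<in>Basis. (norm (A b x))\<^sup>2)" for x
  define p where "p R x = max 0 (1 - (norm x)\<^sup>2 / R\<^sup>2)" for R :: real and x :: 'a
  have Dg: "(g has_derivative (\<lambda>h. G h x)) (at x)" for x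
    using k_smooth_2D(1)[OF g] by (simp add: G_def[abs_def] frechet_derivative_works[symmetric])
  have DG: "(G b has_derivative H b x) (at x)" for b x
    using k_smooth_2D(2)[OF g] by (simp add: G_def[abs_def] H_def frechet_derivative_works[symmetric])
  have contg [continuous_intros]: "continuous_on UNIV g"
    by (intro continuous_at_imp_continuous_on ballI has_derivative_continuous[OF Dg])
  have contG [continuous_intros]: "continuous_on UNIV (G b)" for b
    by (intro continuous_at_imp_continuous_on ballI has_derivative_continuous[OF DG])
  have contH [continuous_intros]: "continuous_on UNIV (\<lambda>x. H b x c)" for b c
    using g by (simp add: numeral_2_eq_2 G_def[abs_def] H_def)
  have contA [continuous_intros]: "continuous_on UNIV (A b)" for b
    unfolding A_def by (intro continuous_intros)
  have contp [continuous_intros]: "continuous_on UNIV (p R)" for R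
    unfolding p_def divide_inverse by (intro continuous_intros)
  have contS [continuous_intros]: "continuous_on UNIV S"
    unfolding S_def by (intro continuous_intros)
  have normsum: "(\<Sum>b\<in>Basis. (x \<bullet> b)\<^sup>2) = (norm x)\<^sup>2" for x :: 'a
    unfolding power2_norm_eq_inner by (subst euclidean_inner) (simp add: power2_eq_square)
  have p_supp: "p R x = 0" if "R > 0" "norm x > R" for R x
  proof -
    have "R\<^sup>2 \<le> (norm x)\<^sup>2" using that by (intro power_mono) auto
    then show ?thesis using that by (simp add: p_def max_def field_simps)
  qed
  have Dp: "((\<lambda>x. (p R x)\<^sup>2) has_derivative (\<lambda>h. - 4 * p R x * (x \<bullet> h) / R\<^sup>2)) (at x)" for R x
  proof -
    \<comment> \<open>Writing the squared norm as \<open>x \<bullet> x\<close> avoids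
      differentiating \<open>norm\<close>, which fails at the origin.\<close>
    have "((\<lambda>x. 1 - (x \<bullet> x) / R\<^sup>2) has_derivative (\<lambda>h. - (2 * (x \<bullet> h)) / R\<^sup>2)) (at x)"
      unfolding divide_inverse by (auto intro!: derivative_eq_intros simp: inner_commute)
    from has_derivative_compose[OF this
        has_real_derivative_pos_part_square[unfolded has_field_derivative_def]]
    have "((\<lambda>x. (max 0 (1 - (x \<bullet> x) / R\<^sup>2))\<^sup>2) has_derivative
        (\<lambda>h. 2 * max 0 (1 - (x \<bullet> x) / R\<^sup>2) * (- (2 * (x \<bullet> h)) / R\<^sup>2))) (at x)" .
    then show ?thesis
      unfolding p_def power2_norm_eq_inner by (simp add: algebra_simps)
  qed
  \<comment> \<open>A Caccioppoli estimate: Young's inequality absorbs half of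
    \<open>(p R x)\<^sup>2 * S x\<close> at the cost of
    \<open>8 / R\<^sup>2 * (norm (g x))\<^sup>2\<close>; doubling to restore the absorbed half gives
    the constant 16.\<close>
  have energy: "(\<integral>x. (p R x)\<^sup>2 * S x \<partial>lborel) \<le> 16 / R\<^sup>2 * (\<integral>x. (norm (g x))\<^sup>2 \<partial>lborel)"
    if R: "R > 0" for R
  proof -
    \<comment> \<open>The \<open>F b\<close> are the components of a compactly supported vector
      field and \<open>F' b x\<close> are their derivatives, so that the sum of
      \<open>F' b x b\<close> is its divergence, with integral 0.\<close>
    define F where "F b x = (p R x)\<^sup>2 * (g x \<bullet> A b x)" for b x
    define F' where "F' b x h = - 4 * p R x * (x \<bullet> h) / R\<^sup>2 * (g x \<bullet> A b x) + (p R x)\<^sup>2 *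
        (G h x \<bullet> A b x + g x \<bullet> (H b x h + (h \<bullet> b) *\<^sub>R g x + (x \<bullet> b) *\<^sub>R G h x))" for b x h
    have DF: "(F b has_derivative F' b x) (at x)" for b x
      unfolding F_def A_def F'_def
      by (rule derivative_eq_intros Dp Dg DG refl)+ (simp add: fun_eq_iff algebra_simps)
    have contF': "continuous_on UNIV (\<lambda>x. F' b x b)" for b
      unfolding F'_def divide_inverse by (intro continuous_intros)
    have F'_supp: "F' b x h = 0" if "norm x > R" for b x h
      using p_supp[OF R that] by (simp add: F'_def)
    have intF': "integrable lborel (\<lambda>x. F' b x b)" for b
      by (rule integrable_continuous_compact_support[OF contF' F'_supp])
    have "(\<integral>x. F' b x b \<partial>lborel) = 0" for b
      by (rule integral_directional_derivative_eq_0[OF DF contF', of R])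
         (simp add: F_def p_supp R)
    then have int0: "(\<integral>x. (\<Sum>b\<in>Basis. F' b x b) \<partial>lborel) = 0"
      using intF' by simp
    have div: "(\<Sum>b\<in>Basis. F' b x b) =
      (p R x)\<^sup>2 * S x - (\<Sum>b\<in>Basis. 4 * p R x * (x \<bullet> b) / R\<^sup>2 * (g x \<bullet> A b x))" for x
    proof -
      \<comment> \<open>The terms \<open>b \<bullet> b\<close> add up to \<open>DIM('a)\<close> and
        cancel the \<open>- DIM('a)\<close> of the equation: this is where the exact eigenvalue
        enters. Once \<open>(norm x)\<^sup>2\<close> is spread over the coordinates, the rest is a
        sum of squares.\<close>
      have "(\<Sum>b\<in>Basis. G b x \<bullet> A b x + g x \<bullet> (H b x b + (b \<bullet> b) *\<^sub>R g x + (x \<bullet> b) *\<^sub>R G b x)) =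
          (\<Sum>b\<in>Basis. G b x \<bullet> G b x + 2 * (x \<bullet> b) * (g x \<bullet> G b x)) + g x \<bullet> (\<Sum>b\<in>Basis. H b x b)
            + DIM('a) * (g x \<bullet> g x)"
        by (simp add: A_def sum.distrib inner_sum_right inner_add_right inner_commute
            sum_distrib_left algebra_simps)
      also have "(\<Sum>b\<in>Basis. H b x b) = ((norm x)\<^sup>2 - DIM('a)) *\<^sub>R g x"
        using eq[of x] by (simp add: H_def G_def[abs_def])
      also have "(\<Sum>b\<in>Basis. G b x \<bullet> G b x + 2 * (x \<bullet> b) * (g x \<bullet> G b x)) +
          g x \<bullet> (((norm x)\<^sup>2 - DIM('a)) *\<^sub>R g x) + DIM('a) * (g x \<bullet> g x) =
          (\<Sum>b\<in>Basis. G b x \<bullet> G b x + 2 * (x \<bullet> b) * (g x \<bullet> G b x)) + (norm x)\<^sup>2 * (g x \<bullet> g x)"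
        by (simp add: algebra_simps)
      also have "\<dots> = (\<Sum>b\<in>Basis. G b x \<bullet> G b x + 2 * (x \<bullet> b) * (g x \<bullet> G b x) + (x \<bullet> b)\<^sup>2 * (g x \<bullet> g x))"
        by (simp add: sum.distrib sum_distrib_right flip: normsum)
      also have "\<dots> = S x"
        unfolding S_def A_def power2_norm_eq_inner
        by (intro sum.cong refl)
           (simp add: inner_add_left inner_add_right inner_commute power2_eq_square algebra_simps)
      finally have sum_eq: "S x = (\<Sum>b\<in>Basis. G b x \<bullet> A b x +
          g x \<bullet> (H b x b + (b \<bullet> b) *\<^sub>R g x + (x \<bullet> b) *\<^sub>R G b x))" ..
      show ?thesis
        unfolding F'_def sum_eq sum_distrib_left sum_subtractf[symmetric] by (intro sum.cong) simp_all
    qed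
    have pointwise: "(p R x)\<^sup>2 * S x \<le> 2 * (\<Sum>b\<in>Basis. F' b x b) + 16 / R\<^sup>2 * (norm (g x))\<^sup>2" for x
    proof (cases "norm x > R")
      case True
      then show ?thesis using p_supp[OF R True] F'_supp[OF True] by simp
    next
      case False
      have "4 * p R x * (x \<bullet> b) / R\<^sup>2 * (g x \<bullet> A b x) \<le>
          (p R x)\<^sup>2 / 2 * (norm (A b x))\<^sup>2 + 8 / R^4 * (x \<bullet> b)\<^sup>2 * (norm (g x))\<^sup>2" for b
      proof -
        define u where "u = p R x * norm (A b x)"
        define v where "v = \<bar>x \<bullet> b\<bar> * norm (g x) / R\<^sup>2"
        have p0: "p R x \<ge> 0" by (simp add: p_def)
        have "4 * p R x * (x \<bullet> b) / R\<^sup>2 * (g x \<bullet> A b x) \<le> \<bar>4 * p R x * (x \<bullet> b) / R\<^sup>2 * (g x \<bullet> A b x)\<bar>"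
          by (rule abs_ge_self)
        also have "\<dots> = 4 * p R x * \<bar>x \<bullet> b\<bar> / R\<^sup>2 * \<bar>g x \<bullet> A b x\<bar>"
          using p0 by (simp add: abs_mult)
        also have "\<dots> \<le> 4 * p R x * \<bar>x \<bullet> b\<bar> / R\<^sup>2 * (norm (g x) * norm (A b x))"
          using p0 by (intro mult_left_mono Cauchy_Schwarz_ineq2) auto
        also have "\<dots> = 4 * (u * v)" by (simp add: u_def v_def)
        \<comment> \<open>This is half of \<open>(u - 4 * v)\<^sup>2 \<ge> 0\<close>; the weight 4
          leaves \<open>u\<^sup>2\<close> the coefficient 1/2 that can be absorbed.\<close>
        also have "\<dots> \<le> u\<^sup>2 / 2 + 8 * v\<^sup>2"
          using zero_le_power2[of "u - 4 * v"] by (simp add: power2_eq_square algebra_simps)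
        also have "\<dots> = (p R x)\<^sup>2 / 2 * (norm (A b x))\<^sup>2 + 8 / R^4 * (x \<bullet> b)\<^sup>2 * (norm (g x))\<^sup>2"
          by (simp add: u_def v_def power_mult_distrib power_divide flip: power_mult)
        finally show ?thesis .
      qed
      then have "(\<Sum>b\<in>Basis. 4 * p R x * (x \<bullet> b) / R\<^sup>2 * (g x \<bullet> A b x)) \<le>
          (\<Sum>b\<in>Basis. (p R x)\<^sup>2 / 2 * (norm (A b x))\<^sup>2 + 8 / R^4 * (x \<bullet> b)\<^sup>2 * (norm (g x))\<^sup>2)"
        by (rule sum_mono)
      also have "\<dots> = (p R x)\<^sup>2 / 2 * S x + 8 / R^4 * (norm x)\<^sup>2 * (norm (g x))\<^sup>2"
        unfolding S_def normsum[symmetric] by (simp only: sum.distrib sum_distrib_left sum_distrib_right)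
      \<comment> \<open>Inside the ball, \<open>norm x \<le> R\<close> turns the denominator
        \<open>R^4\<close> into \<open>R\<^sup>2\<close>.\<close>
      also have "8 / R^4 * (norm x)\<^sup>2 * (norm (g x))\<^sup>2 \<le> 8 / R^4 * R\<^sup>2 * (norm (g x))\<^sup>2"
        using False by (intro mult_right_mono mult_left_mono power_mono) auto
      also have "8 / R^4 * R\<^sup>2 = 8 / R\<^sup>2"
        using R by (simp add: field_simps flip: power_add)
      finally have "(p R x)\<^sup>2 * S x - (\<Sum>b\<in>Basis. F' b x b) \<le>
          (p R x)\<^sup>2 / 2 * S x + 8 / R\<^sup>2 * (norm (g x))\<^sup>2"
        unfolding div by simp
      then show ?thesis by simp
    qed
    have "(\<integral>x. (p R x)\<^sup>2 * S x \<partial>lborel) \<le>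
        (\<integral>x. 2 * (\<Sum>b\<in>Basis. F' b x b) + 16 / R\<^sup>2 * (norm (g x))\<^sup>2 \<partial>lborel)"
    proof (rule integral_mono)
      show "integrable lborel (\<lambda>x. (p R x)\<^sup>2 * S x)"
        by (rule integrable_continuous_compact_support[of _ R])
           (auto intro!: continuous_intros simp: p_supp R)
    qed (use intF' L2 pointwise in auto)
    also have "\<dots> = 16 / R\<^sup>2 * (\<integral>x. (norm (g x))\<^sup>2 \<partial>lborel)"
      using int0 intF' L2 by simp
    finally show ?thesis .
  qed
  have S0: "S x = 0" for x
  proof -
    \<comment> \<open>As \<open>r\<close> exceeds \<open>norm x\<close>, the weight
      \<open>p r x\<close> at the given point is positive. It stays fixed while \<open>R\<close>
      tends to infinity, because \<open>p r\<close> lies below \<open>p R\<close>.\<close>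
    define r where "r = norm x + 1"
    have r: "r > 0" by (simp add: r_def add_nonneg_pos)
    have S_nonneg: "S x \<ge> 0" for x by (simp add: S_def sum_nonneg)
    have int: "integrable lborel (\<lambda>x. (p R x)\<^sup>2 * S x)" if "R > 0" for R
      by (rule integrable_continuous_compact_support[of _ R])
         (auto intro!: continuous_intros simp: p_supp that)
    let ?J = "\<integral>x. (p r x)\<^sup>2 * S x \<partial>lborel" and ?N = "\<integral>x. (norm (g x))\<^sup>2 \<partial>lborel"
    have "?J \<le> 16 / R\<^sup>2 * ?N" if R: "R \<ge> r" for R
    proof -
      have "?J \<le> (\<integral>x. (p R x)\<^sup>2 * S x \<partial>lborel)"
      proof (rule integral_mono)
        fix x :: 'a
        have "r\<^sup>2 \<le> R\<^sup>2" using R r by (intro power_mono) auto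
        then have "(norm x)\<^sup>2 / R\<^sup>2 \<le> (norm x)\<^sup>2 / r\<^sup>2"
          using r R by (intro divide_left_mono) auto
        then have "p r x \<le> p R x" "0 \<le> p r x" by (auto simp: p_def)
        then show "(p r x)\<^sup>2 * S x \<le> (p R x)\<^sup>2 * S x"
          by (intro mult_right_mono power_mono S_nonneg)
      qed (use int r R in auto)
      also have "\<dots> \<le> 16 / R\<^sup>2 * ?N" using energy r R by simp
      finally show ?thesis .
    qed
    then have "\<forall>\<^sub>F R in at_top. ?J \<le> 16 / R\<^sup>2 * ?N"
      by (intro eventually_mono[OF eventually_ge_at_top[of r]])
    moreover have "((\<lambda>R::real. 16 / R\<^sup>2 * ?N) \<longlongrightarrow> 0 * ?N) at_top"
      by (intro tendsto_intros real_tendsto_divide_at_top[OF tendsto_const] filterlim_pow_at_top filterlim_ident) auto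
    ultimately have "?J \<le> 0"
      by (intro tendsto_lowerbound[of "\<lambda>R. 16 / R\<^sup>2 * ?N"]) auto
    then have "?J = 0"
      by (intro antisym integral_nonneg) (auto simp: S_nonneg)
    then have "AE x in lborel. (p r x)\<^sup>2 * S x = 0"
      using int[OF r] S_nonneg by (subst (asm) integral_nonneg_eq_0_iff_AE) auto
    then have "(p r x)\<^sup>2 * S x = 0"
      by (intro continuous_AE_lborel_eq_0) (intro continuous_intros)
    moreover have "(norm x)\<^sup>2 < r\<^sup>2"
      by (intro power_strict_mono) (auto simp: r_def)
    then have "p r x > 0" using r by (simp add: p_def)
    ultimately show ?thesis by simp
  qed
  \<comment> \<open>This is \<open>A = 0\<close>; from the basis directions it extends to all
    \<open>v\<close> by linearity.\<close>
  have GA: "G v x = - ((x \<bullet> v) *\<^sub>R g x)" for v x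
  proof -
    have lin: "linear (\<lambda>v. G v x)" using Dg has_derivative_linear by blast
    have "(norm (A b x))\<^sup>2 = 0" if "b \<in> Basis" for b
      using S0[of x] that unfolding S_def by (subst (asm) sum_nonneg_eq_0_iff) auto
    then have "G b x = - ((x \<bullet> b) *\<^sub>R g x)" if "b \<in> Basis" for b
      using that by (simp add: A_def eq_neg_iff_add_eq_0)
    moreover have "G v x = (\<Sum>b\<in>Basis. (v \<bullet> b) *\<^sub>R G b x)"
      using linear_sum[OF lin, of "\<lambda>b. (v \<bullet> b) *\<^sub>R b" Basis]
      by (simp add: euclidean_representation linear_scale[OF lin])
    ultimately have "G v x = - (\<Sum>b\<in>Basis. ((x \<bullet> b) * (v \<bullet> b)) *\<^sub>R g x)"
      by (simp add: sum_negf mult.commute)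
    then show ?thesis
      by (simp add: euclidean_inner[of x v] flip: scaleR_sum_left)
  qed
  \<comment> \<open>The exponential is the integrating factor of the first-order equation
    \<open>GA\<close>: the product has derivative zero, so it is constant.\<close>
  have "((\<lambda>x. exp ((x \<bullet> x) / 2) *\<^sub>R g x) has_derivative (\<lambda>h. 0)) (at x)" for x
    by (auto intro!: derivative_eq_intros Dg simp: GA inner_commute algebra_simps)
  then have "exp ((x \<bullet> x) / 2) *\<^sub>R g x = exp ((0 \<bullet> 0) / 2) *\<^sub>R g (0::'a)"
    using has_derivative_zero_unique[of UNIV "\<lambda>x. exp ((x \<bullet> x) / 2) *\<^sub>R g x" x 0] by auto
  then have "exp (- (norm x)\<^sup>2 / 2) *\<^sub>R (exp ((x \<bullet> x) / 2) *\<^sub>R g x) = exp (- (norm x)\<^sup>2 / 2) *\<^sub>R g 0"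
    by simp
  then show ?thesis
    by (simp add: power2_norm_eq_inner flip: exp_add)
qed

section \<open>The Gaussian eigenfunction on the covering\<close>

lemma smooth_coinduct:
  assumes "f \<in> S"
    and "\<And>f. f \<in> S \<Longrightarrow> \<exists>f'. (\<forall>x. (f has_derivative f' x) (at x)) \<and> (\<forall>v. (\<lambda>x. f' x v) \<in> S)"
  shows "smooth f"
proof -
  \<comment> \<open>The induction on \<open>k\<close> treats all members of \<open>S\<close> at
    once, since the derivatives of \<open>f\<close> are other members.\<close>
  have "k_smooth k f" if "f \<in> S" for k f
    using that
  proof (induction k arbitrary: f)
    case 0
    then obtain f' where "\<And>x. (f has_derivative f' x) (at x)" using assms(2) by blast
    then show ?case
      by (auto intro!: continuous_at_imp_continuous_on has_derivative_continuous)
  next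
    case (Suc k)
    then obtain f' where f': "\<And>x. (f has_derivative f' x) (at x)" "\<And>v. (\<lambda>x. f' x v) \<in> S"
      using assms(2) by blast
    have "frechet_derivative f (at x) = f' x" for x
      using frechet_derivative_at[OF f'(1)] by simp
    then show ?case
      using f' Suc.IH by (auto simp: differentiable_def)
  qed
  then show ?thesis using assms(1) by (simp add: smooth_def)
qed

text \<open>The eigenfunction pulled back to the covering. As a single exponential of a polynomial
  it reproduces itself under differentiation up to a polynomial factor.\<close>

definition gauss_cis :: "'a::euclidean_space \<times> real \<Rightarrow> complex" where
  "gauss_cis p = exp (of_real (- (fst p \<bullet> fst p) / 2) + \<i> * of_real (snd p))"

lemma gauss_cis_eq: "gauss_cis (y, t) = cis t * of_real (exp (- (norm y)\<^sup>2 / 2))"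
  by (simp add: gauss_cis_def cis_conv_exp power2_norm_eq_inner flip: exp_of_real exp_add)

lemma has_derivative_gauss_cis:
  "(gauss_cis has_derivative
     (\<lambda>h. (of_real (- (fst p \<bullet> fst h)) + \<i> * of_real (snd h)) * gauss_cis p)) (at p)"
proof -
  have "((\<lambda>p::'a \<times> real. of_real (- (fst p \<bullet> fst p) / 2) + \<i> * of_real (snd p) :: complex)
      has_derivative (\<lambda>h. of_real (- (fst p \<bullet> fst h)) + \<i> * of_real (snd h))) (at p)"
    by (auto intro!: derivative_eq_intros simp: inner_commute)
  from has_derivative_compose[OF this DERIV_exp[unfolded has_field_derivative_def]]
  show ?thesis
    by (simp add: gauss_cis_def[abs_def] mult.commute)
qed

text \<open>Multiples of \<open>gauss_cis\<close> by polynomials: a class of functions closed under directional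
  derivatives and containing \<open>gauss_cis\<close>, so that all its members are smooth.\<close>

inductive_set polynomial_gauss_cis :: "('a::euclidean_space \<times> real \<Rightarrow> complex) set" where
  base: "gauss_cis \<in> polynomial_gauss_cis"
| add: "f \<in> polynomial_gauss_cis \<Longrightarrow> g \<in> polynomial_gauss_cis \<Longrightarrow>
    (\<lambda>p. f p + g p) \<in> polynomial_gauss_cis"
| cmult: "f \<in> polynomial_gauss_cis \<Longrightarrow> (\<lambda>p. c * f p) \<in> polynomial_gauss_cis"
| mult: "bounded_linear l \<Longrightarrow> f \<in> polynomial_gauss_cis \<Longrightarrow>
    (\<lambda>p. l p * f p) \<in> polynomial_gauss_cis"

lemma polynomial_gauss_cis_derivative:
  assumes "f \<in> polynomial_gauss_cis"
  shows "\<exists>f'. (\<forall>x. (f has_derivative f' x) (at x)) \<and> (\<forall>v. (\<lambda>x. f' x v) \<in> polynomial_gauss_cis)"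
  using assms
proof induction
  case base
  have "(\<lambda>p. (of_real (- (fst p \<bullet> fst h)) + \<i> * of_real (snd h)) * gauss_cis p) \<in> polynomial_gauss_cis"
    for h :: "'a \<times> real"
  proof -
    have "bounded_linear (\<lambda>p::'a \<times> real. of_real (- (fst p \<bullet> fst h)) :: complex)"
      by (intro bounded_linear_compose[OF bounded_linear_of_real] bounded_linear_minus
          bounded_linear_compose[OF bounded_linear_inner_left] bounded_linear_fst)
    then show ?thesis
      unfolding distrib_right by (intro polynomial_gauss_cis.intros)
  qed
  then show ?case
    using has_derivative_gauss_cis
    by (intro exI[of _ "\<lambda>p h. (of_real (- (fst p \<bullet> fst h)) + \<i> * of_real (snd h)) * gauss_cis p"])
       blast
next
  case (add f g)
  then obtain f' g' where
    "\<And>x. (f has_derivative f' x) (at x)" "\<And>v. (\<lambda>x. f' x v) \<in> polynomial_gauss_cis"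
    "\<And>x. (g has_derivative g' x) (at x)" "\<And>v. (\<lambda>x. g' x v) \<in> polynomial_gauss_cis"
    by blast
  then show ?case
    by (intro exI[of _ "\<lambda>x v. f' x v + g' x v"] conjI allI has_derivative_add polynomial_gauss_cis.add) auto
next
  case (cmult f c)
  then obtain f' where
    "\<And>x. (f has_derivative f' x) (at x)" "\<And>v. (\<lambda>x. f' x v) \<in> polynomial_gauss_cis"
    by blast
  then show ?case
    by (intro exI[of _ "\<lambda>x v. c * f' x v"] conjI allI has_derivative_mult_right
        polynomial_gauss_cis.cmult) auto
next
  case (mult l f)
  then obtain f' where
    f': "\<And>x. (f has_derivative f' x) (at x)" "\<And>v. (\<lambda>x. f' x v) \<in> polynomial_gauss_cis"
    by blast
  have "((\<lambda>p. l p * f p) has_derivative (\<lambda>h. l x * f' x h + l h * f x)) (at x)" for x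
    by (rule has_derivative_mult[OF bounded_linear_imp_has_derivative[OF mult.hyps(1)] f'(1)])
  moreover have "(\<lambda>x. l x * f' x v + l v * f x) \<in> polynomial_gauss_cis" for v
    by (intro polynomial_gauss_cis.add polynomial_gauss_cis.mult polynomial_gauss_cis.cmult mult.hyps f')
  ultimately show ?case
    by (intro exI[of _ "\<lambda>x v. l x * f' x v + l v * f x"]) blast
qed

lemma smooth_gauss_cis: "smooth gauss_cis"
  by (rule smooth_coinduct[OF polynomial_gauss_cis.base polynomial_gauss_cis_derivative])

lemma frechet_derivative_gauss_cis:
  "frechet_derivative gauss_cis (at p) h =
     (of_real (- (fst p \<bullet> fst h)) + \<i> * of_real (snd h)) * gauss_cis p"
  using fun_cong[OF frechet_derivative_at[OF has_derivative_gauss_cis[of p]], of h] by simp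

text \<open>Both kinds of direction in the Laplacian are instances: \<open>(axis i 1, 0)\<close>
  yields the factor \<open>(y $ i)\<^sup>2 - 1\<close>, and \<open>(0, 1)\<close> yields -1.\<close>

lemma frechet_derivative_gauss_cis_2:
  "frechet_derivative (\<lambda>z. frechet_derivative gauss_cis (at z) h) (at p) h =
     ((of_real (- (fst p \<bullet> fst h)) + \<i> * of_real (snd h))\<^sup>2 - of_real (fst h \<bullet> fst h)) * gauss_cis p"
proof -
  have "((\<lambda>z. (of_real (- (fst z \<bullet> fst h)) + \<i> * of_real (snd h)) * gauss_cis z) has_derivative
      (\<lambda>k. (of_real (- (fst p \<bullet> fst h)) + \<i> * of_real (snd h)) *
          ((of_real (- (fst p \<bullet> fst k)) + \<i> * of_real (snd k)) * gauss_cis p)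
        + of_real (- (fst k \<bullet> fst h)) * gauss_cis p)) (at p)"
    by (rule has_derivative_mult[OF _ has_derivative_gauss_cis]) (auto intro!: derivative_eq_intros)
  from frechet_derivative_at[OF this, symmetric] show ?thesis
    by (simp add: frechet_derivative_gauss_cis power2_eq_square algebra_simps)
qed

section \<open>Integrability on the product with the circle\<close>

lemma emeasure_circle_measure: "emeasure circle_measure (space circle_measure) = ennreal (2 * pi)"
proof -
  have "emeasure circle_measure (space circle_measure) =
      emeasure (restrict_space lborel {0..<2 * pi}) (space (restrict_space lborel {0..<2 * pi}))"
    unfolding circle_measure_def
    using sets.top[of "vimage_algebra UNIV Rep_circle borel"]
    by (subst emeasure_distr[OF measurable_circ])
       (auto simp: space_restrict_space intro!: arg_cong2[where f=emeasure])
  then show ?thesis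
    by (simp add: emeasure_restrict_space space_restrict_space)
qed

text \<open>By Tonelli the circle contributes the factor \<open>2 * pi\<close>, which is finite and
  nonzero, so the two integrals are finite together.\<close>

lemma integrable_measure_BS_fst_iff:
  fixes h :: "real^'n \<Rightarrow> real"
  assumes [measurable]: "h \<in> borel_measurable borel" and nonneg: "\<And>y. h y \<ge> 0"
  shows "integrable measure_BS (\<lambda>u. h (fst u)) \<longleftrightarrow> integrable lborel h"
proof -
  interpret circle: finite_measure circle_measure
    by standard (simp add: emeasure_circle_measure)
  have "(\<integral>\<^sup>+u. ennreal (h (fst u)) \<partial>measure_BS) = (\<integral>\<^sup>+y. \<integral>\<^sup>+z. ennreal (h y) \<partial>circle_measure \<partial>lborel)"
    unfolding measure_BS_def by (subst circle.nn_integral_fst[symmetric]) auto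
  also have "\<dots> = (\<integral>\<^sup>+y. ennreal (h y) \<partial>lborel) * ennreal (2 * pi)"
    by (simp add: emeasure_circle_measure nn_integral_multc)
  finally have "(\<integral>\<^sup>+u. ennreal (h (fst u)) \<partial>measure_BS) < \<infinity> \<longleftrightarrow> (\<integral>\<^sup>+y. ennreal (h y) \<partial>lborel) < \<infinity>"
    by (auto simp: ennreal_mult_less_top)
  moreover have "(\<lambda>u. h (fst u)) \<in> borel_measurable measure_BS"
    unfolding measure_BS_def by measurable
  ultimately show ?thesis
    by (simp add: integrable_iff_bounded nonneg)
qed

section \<open>Complex dimension\<close>

lemma has_cdim_span:
  assumes "finite B" "\<not> cfun.dependent B"
  shows "has_cdim (cfun.span B) (card B)"
  using assms by (auto simp: has_cdim_def cfun.dim_eq_card_independent)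

lemma has_cdim_0: "has_cdim {\<lambda>_. 0} 0"
  using has_cdim_span[of "{}"] by (simp add: cfun.independent_empty zero_fun_def)

lemma has_cdim_1:
  assumes "f \<noteq> (\<lambda>_. 0)"
  shows "has_cdim {\<lambda>u. c * f u |c. True} 1"
proof -
  have "cfun.span {f} = {\<lambda>u. c * f u |c. True}"
    by (auto simp: cfun.span_singleton)
  then show ?thesis
    using has_cdim_span[of "{f}"] assms by (simp add: zero_fun_def)
qed

section \<open>The invariant eigenspaces\<close>

lemma sum_Basis_vec:
  "(\<Sum>b\<in>(Basis :: (real^'n) set). h b) = (\<Sum>i\<in>UNIV. h (axis i 1))"
proof -
  have "Basis = range (\<lambda>i::'n. axis i (1::real))" by (auto simp: Basis_vec_def)
  moreover have "inj (\<lambda>i::'n. axis i (1::real))" by (auto simp: inj_on_def axis_eq_axis)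
  ultimately show ?thesis
    using sum.reindex[of "\<lambda>i::'n. axis i (1::real)" UNIV h] by simp
qed

lemma circ_cases:
  obtains y t where "u = (y, circ t)"
  using that[of "fst u" "Arg (Rep_circle (snd u))"] by (simp add: circ_Arg)

lemma smooth_0: "smooth (\<lambda>_. 0)"
  by (rule smooth_coinduct[of _ "{\<lambda>_. 0}"]) (auto intro!: exI[of _ "\<lambda>_ _. 0"])

lemma zero_in_W_BS:
  assumes "m > 0"
  shows "(\<lambda>_. 0) \<in> (W_BS m ev :: ((real^'n) \<times> circle \<Rightarrow> complex) set)"
proof -
  have 0: "(\<lambda>_. 0) \<in> (smooth_BS :: ((real^'n) \<times> circle \<Rightarrow> complex) set)"
    by (simp add: smooth_BS_def smooth_0)
  have "laplacian_BS m (\<lambda>_. 0) (y, circ t) = 0" for y :: "real^'n" and t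
    by (simp add: laplacian_BS_formula[OF 0 assms])
  then have "laplacian_BS m (\<lambda>_. 0) u = 0" for u :: "(real^'n) \<times> circle"
    by (cases u rule: circ_cases) simp
  with 0 show ?thesis
    by (simp add: W_BS_def invariant_eigenspace_def invariant_functions_def)
qed

lemma W_BS_gt_1:
  assumes m: "m > 1"
  shows "(W_BS m ev :: ((real^'n) \<times> circle \<Rightarrow> complex) set) = {\<lambda>_. 0}"
proof -
  have "f = (\<lambda>_. 0)" if f: "f \<in> invariant_functions (action_BS m)"
    for f :: "(real^'n) \<times> circle \<Rightarrow> complex"
  proof
    fix u :: "(real^'n) \<times> circle"
    define s where "s = circ (2 * pi / m)"
    have "Rep_circle s ^ m = 1"
      using m by (simp add: s_def Complex.DeMoivre)
    then have "action_BS m u s = u"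
      by (simp add: action_BS_def Rep_circle_inverse)
    moreover have "inverse (Rep_circle s) * f (action_BS m u s) = f u"
      using f unfolding invariant_functions_def by blast
    \<comment> \<open>As \<open>m \<ge> 2\<close>, the angle lies in \<open>(0, pi]\<close>, where
      the cosine is strictly below 1; comparing real parts shows that \<open>s\<close> is not
      1.\<close>
    moreover have "cos (2 * pi / m) < cos 0"
      using m by (intro cos_monotone_0_pi) (auto simp: field_simps)
    then have "Rep_circle s \<noteq> 1"
      by (auto simp: s_def complex_eq_iff)
    ultimately show "f u = 0"
      by auto
  qed
  moreover have "(\<lambda>_. 0) \<in> (W_BS m ev :: ((real^'n) \<times> circle \<Rightarrow> complex) set)"
    using m by (intro zero_in_W_BS) simp
  ultimately show ?thesis
    unfolding W_BS_def invariant_eigenspace_def by blast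
qed

lemma W_nonBS_eq: "W_nonBS ev = {\<lambda>_. 0}"
proof -
  have "f = (\<lambda>_. 0)" if "f \<in> invariant_functions (\<lambda>u s. u)" for f :: "real^'a \<Rightarrow> complex"
  proof
    fix u
    \<comment> \<open>The element -1 of the circle turns invariance into
      \<open>- f u = f u\<close>.\<close>
    have "inverse (Rep_circle (circ pi)) * f u = f u"
      using that by (auto simp: invariant_functions_def simp del: Rep_circ)
    then show "f u = 0" by simp
  qed
  moreover have "(\<lambda>_. 0) \<in> W_nonBS ev"
    by (simp add: W_nonBS_def invariant_eigenspace_def invariant_functions_def smooth_0
        laplacian_nonBS_formula)
  ultimately show ?thesis
    unfolding W_nonBS_def invariant_eigenspace_def by blast
qed

text \<open>This is \<open>gauss_cis\<close> descended from the covering; the circle coordinate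
  itself is the phase.\<close>

definition gauss_circle :: "(real^'n) \<times> circle \<Rightarrow> complex" where
  "gauss_circle u = Rep_circle (snd u) * of_real (exp (- (norm (fst u))\<^sup>2 / 2))"

lemma gauss_circle_cover: "gauss_circle (cover p) = gauss_cis p"
  using gauss_cis_eq[of "fst p" "snd p"] by (simp add: gauss_circle_def cover_def)

text \<open>The directions of \<open>y\<close> contribute the factor \<open>n - |y|\<^sup>2\<close>
  and the circle direction \<open>1 + |y|\<^sup>2\<close>, which add up to \<open>n + 1\<close>.
  Since the phase has modulus 1, square integrability is that of the Gaussian.\<close>

lemma gauss_circle_in_W_BS:
  "(\<lambda>u :: (real^'n) \<times> circle. c * gauss_circle u) \<in> W_BS 1 (real CARD('n) + 1)"
proof -
  let ?f = "\<lambda>u :: (real^'n) \<times> circle. c * gauss_circle u"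
  have E: "k_smooth k (gauss_cis :: (real^'n) \<times> real \<Rightarrow> complex)" for k
    using smooth_gauss_cis unfolding smooth_def by blast
  have smooth: "?f \<in> smooth_BS"
    using k_smooth_bounded_linear[OF bounded_linear_mult_right E]
    by (simp add: smooth_BS_def smooth_def gauss_circle_cover)
  have laplacian: "laplacian_BS 1 ?f (y, circ t) = of_real (real CARD('n) + 1) * ?f (y, circ t)" for y t
  proof -
    have "(\<Sum>i\<in>UNIV. ((of_real (- (y $ i)))\<^sup>2 - 1) * gauss_cis (y, t)) =
        (of_real ((norm y)\<^sup>2) - of_nat CARD('n)) * gauss_cis (y, t)"
      by (simp add: norm_vec_def L2_set_def sum_nonneg sum_subtractf flip: sum_distrib_right)
    moreover have "laplacian_BS 1 ?f (y, circ t) =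
        - (c * (\<Sum>i\<in>UNIV. ((of_real (- (y $ i)))\<^sup>2 - 1) * gauss_cis (y, t)))
        + of_real (1 + (norm y)\<^sup>2) * (c * gauss_cis (y, t))"
      by (simp add: laplacian_BS_formula[OF smooth] gauss_circle_cover
          frechet_derivative_bounded_linear_2[OF bounded_linear_mult_right E]
          frechet_derivative_gauss_cis_2 inner_axis inner_axis_axis sum_distrib_left)
    moreover have "gauss_circle (y, circ t) = gauss_cis (y, t)"
      using gauss_circle_cover[of "(y, t)"] by (simp add: cover_def)
    ultimately show ?thesis
      by (simp only:) (simp add: algebra_simps)
  qed
  have "laplacian_BS 1 ?f u = of_real (real CARD('n) + 1) * ?f u" for u
    using laplacian by (cases u rule: circ_cases) simp
  moreover have "inverse (Rep_circle s) * ?f (action_BS 1 u s) = ?f u" for s u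
  proof -
    have unit: "norm (Rep_circle z) = 1" for z
      using Rep_circle[of z] by simp
    then have "Rep_circle s \<noteq> 0" by (metis norm_zero zero_neq_one)
    moreover have "Rep_circle (Abs_circle (Rep_circle (snd u) * Rep_circle s)) = Rep_circle (snd u) * Rep_circle s"
      by (rule Abs_circle_inverse) (simp add: norm_mult unit)
    ultimately show ?thesis
      by (simp add: gauss_circle_def action_BS_def)
  qed
  moreover have "integrable measure_BS (\<lambda>u. (cmod (?f u))\<^sup>2)"
  proof -
    have "(cmod (?f u))\<^sup>2 = (cmod c)\<^sup>2 * exp (- (norm (fst u))\<^sup>2)" for u
      using Rep_circle[of "snd u"]
      by (simp add: gauss_circle_def norm_mult power_mult_distrib flip: exp_of_nat_mult)
    then show ?thesis
      by (simp add: integrable_measure_BS_fst_iff[of "\<lambda>y. exp (- (norm y)\<^sup>2)"]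
          integrable_exp_minus_norm_power2)
  qed
  ultimately show ?thesis
    using smooth unfolding W_BS_def invariant_eigenspace_def invariant_functions_def by blast
qed

text \<open>Invariance fixes the dependence on \<open>t\<close>, so \<open>f\<close> is determined
  by its restriction \<open>g\<close> to \<open>t = 0\<close>. The circle direction of the Laplacian
  then acts as multiplication by \<open>1 + |y|\<^sup>2\<close>, and eigenvalue \<open>n + 1\<close>
  becomes the oscillator equation for \<open>g\<close> with eigenvalue \<open>n\<close>.\<close>

lemma W_BS_1_subset:
  assumes f: "f \<in> W_BS 1 (real CARD('n) + 1)"
  shows "f = (\<lambda>u :: (real^'n) \<times> circle. f (0, circ 0) * gauss_circle u)"
proof -
  define F where "F = (\<lambda>p. f (cover p))"
  define g where "g y = F (y, 0)" for y
  have f': "f \<in> smooth_BS" "f \<in> invariant_functions (action_BS 1)"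
    "integrable measure_BS (\<lambda>u. (cmod (f u))\<^sup>2)"
    "\<And>u. laplacian_BS 1 f u = of_real (real CARD('n) + 1) * f u"
    using f by (auto simp: W_BS_def invariant_eigenspace_def)
  have F: "k_smooth 2 F"
    using f'(1) by (simp add: smooth_BS_def smooth_def F_def)
  have l: "bounded_linear (\<lambda>y::real^'n. (y, 0::real))"
    by (intro bounded_linear_Pair bounded_linear_ident bounded_linear_zero)
  have g: "k_smooth 2 g"
    unfolding g_def by (rule k_smooth_comp_bounded_linear[OF l F])
  have rot: "F (y, t + \<tau>) = cis \<tau> * F (y, t)" for y t \<tau>
  proof -
    have "inverse (Rep_circle (circ \<tau>)) * f (action_BS 1 (cover (y, t)) (circ \<tau>)) = f (cover (y, t))"
      using f'(2) unfolding invariant_functions_def by blast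
    then show ?thesis
      by (simp add: action_BS_cover F_def field_simps)
  qed
  have F_g: "f (y, circ t) = cis t * g y" for y t
    using rot[of y 0 t] by (simp add: F_def g_def cover_def)
  \<comment> \<open>The derivative of \<open>F\<close> along the circle is computed twice, by the
    chain rule and by \<open>rot\<close>; uniqueness of derivatives identifies the results.\<close>
  have Dt: "frechet_derivative F (at p) (0, 1) = \<i> * F p" for p
  proof -
    have "((\<lambda>s. F (fst p, snd p + s)) has_derivative (\<lambda>s. frechet_derivative F (at p) (0, s))) (at 0)"
      using k_smooth_2D(1)[OF F]
      by (intro has_derivative_compose[of "\<lambda>s. (fst p, snd p + s)" "\<lambda>s. (0, s)" 0 UNIV F])
         (auto intro!: derivative_eq_intros simp: frechet_derivative_works[symmetric])
    moreover have "((\<lambda>s. cis s * F p) has_derivative (\<lambda>s. \<i> * of_real s * F p)) (at 0)"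
    proof -
      have "((\<lambda>s. \<i> * of_real s) has_derivative (\<lambda>s. \<i> * of_real s)) (at (0::real))"
        by (auto intro!: derivative_eq_intros)
      from has_derivative_compose[OF this DERIV_exp[unfolded has_field_derivative_def]]
      show ?thesis
        by (intro has_derivative_mult_left) (simp add: cis_conv_exp)
    qed
    ultimately have "(\<lambda>s. frechet_derivative F (at p) (0, s)) = (\<lambda>s. \<i> * of_real s * F p)"
      unfolding rot prod.collapse by (rule has_derivative_unique)
    from fun_cong[OF this, of 1] show ?thesis by simp
  qed
  have Dtt: "frechet_derivative (\<lambda>z. frechet_derivative F (at z) (0, 1)) (at p) (0, 1) = - F p" for p
    unfolding Dt using k_smooth_2D(1)[OF F]
    by (simp add: frechet_derivative_bounded_linear[OF bounded_linear_mult_right] Dt)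
  have Dg: "frechet_derivative g (at y) v = frechet_derivative F (at (y, 0)) (v, 0)" for y v
    unfolding g_def using k_smooth_2D(1)[OF F]
    by (rule frechet_derivative_comp_bounded_linear[OF l, of F])
  have Dgg: "frechet_derivative (\<lambda>z. frechet_derivative g (at z) v) (at y) v =
      frechet_derivative (\<lambda>z. frechet_derivative F (at z) (v, 0)) (at (y, 0)) (v, 0)" for y v
    unfolding Dg using k_smooth_2D(2)[OF F]
    by (rule frechet_derivative_comp_bounded_linear[OF l, of "\<lambda>z. frechet_derivative F (at z) (v, 0)"])
  have "(\<Sum>b\<in>Basis. frechet_derivative (\<lambda>z. frechet_derivative g (at z) b) (at y) b) =
      ((norm y)\<^sup>2 - DIM(real^'n)) *\<^sub>R g y" for y
  proof -
    have "laplacian_BS 1 f (y, circ 0) =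
        - (\<Sum>b\<in>Basis. frechet_derivative (\<lambda>z. frechet_derivative g (at z) b) (at y) b)
        + of_real (1 + (norm y)\<^sup>2) * g y"
      using laplacian_BS_formula[OF f'(1), of 1 y 0]
      by (simp add: F_def[symmetric] Dtt sum_Basis_vec Dgg g_def)
    moreover have "laplacian_BS 1 f (y, circ 0) = of_real (real CARD('n) + 1) * g y"
      using f'(4) F_g[of y 0] by simp
    ultimately show ?thesis
      by (simp add: scaleR_conv_of_real algebra_simps)
  qed
  moreover have "integrable lborel (\<lambda>y. (norm (g y))\<^sup>2)"
  proof -
    \<comment> \<open>The phase has modulus 1, so \<open>|f|\<^sup>2\<close> depends on
      \<open>y\<close> alone and its integrability passes to \<open>g\<close>.\<close>
    have "norm (f u) = norm (g (fst u))" for u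
      using F_g[of "fst u" "Arg (Rep_circle (snd u))"] by (simp add: circ_Arg norm_mult)
    moreover have "continuous_on UNIV g"
      using k_smooth_2D(1)[OF g]
      by (intro continuous_at_imp_continuous_on ballI differentiable_imp_continuous_within)
    then have "(\<lambda>y. (norm (g y))\<^sup>2) \<in> borel_measurable borel"
      by (intro borel_measurable_continuous_onI continuous_intros)
    ultimately show ?thesis
      using f'(3) integrable_measure_BS_fst_iff[of "\<lambda>y. (norm (g y))\<^sup>2"] by simp
  qed
  ultimately have g_eq: "g y = exp (- (norm y)\<^sup>2 / 2) *\<^sub>R g 0" for y
    by (rule harmonic_oscillator_ground_state[OF g])
  show ?thesis
  proof
    fix u :: "(real^'n) \<times> circle"
    obtain y t where u: "u = (y, circ t)"
      by (rule circ_cases)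
    show "f u = f (0, circ 0) * gauss_circle u"
      unfolding u F_g using g_eq[of y] by (simp add: gauss_circle_def scaleR_conv_of_real)
  qed
qed

theorem theorem1p3:
  fixes m :: nat
  assumes "m > 0"
  shows "(m = 1 \<longrightarrow>
            has_cdim (W_BS m (real CARD('n) + 1) :: ((real^'n) \<times> circle \<Rightarrow> complex) set) 1)
       \<and> (m > 1 \<longrightarrow>
            has_cdim (W_BS m (real CARD('n) + 1) :: ((real^'n) \<times> circle \<Rightarrow> complex) set) 0)
       \<and> has_cdim (W_nonBS (real CARD('n) + 1) :: (real^'n \<Rightarrow> complex) set) 0"
proof -
  have 1: "W_BS 1 (real CARD('n) + 1) = {\<lambda>u :: (real^'n) \<times> circle. c * gauss_circle u |c. True}"
    using gauss_circle_in_W_BS W_BS_1_subset by blast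
  have "gauss_circle \<noteq> (\<lambda>_ :: (real^'n) \<times> circle. 0)"
    using fun_cong[of gauss_circle "\<lambda>_. 0" "(0, circ 0)"] by (auto simp: gauss_circle_def)
  from has_cdim_1[OF this] show ?thesis
    by (simp add: 1[unfolded One_nat_def] W_BS_gt_1 W_nonBS_eq has_cdim_0)
qed

end
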